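(* Let $a,b,c$ be real numbers with $4ac-b^{2}>0$ and $a+c>0$. Let $(a_n,b_n,c_n)_{n\ge 0}$ be the sequence obtained from $(a_0,b_0,c_0)=(a,b,c)$ by iterating the rational Landen transformation (defined in the context). Then $$\lim_{n\to\infty}a_n=\lim_{n\to\infty}c_n=\tfrac12\sqrt{4ac-b^{2}},\qquad \lim_{n\to\infty}b_n=0.$$
   Context: The rational Landen transformation is the recursion $$a_{n+1}=a_n\,\frac{(a_n+3c_n)^2-3b_n^2}{(3a_n+c_n)(a_n+3c_n)-b_n^2},$$ $$b_{n+1}=b_n\,\frac{3(a_n-c_n)^2-b_n^2}{(3a_n+c_n)(a_n+3c_n)-b_n^2},$$ $$c_{n+1}=c_n\,\frac{(3a_n+c_n)^2-3b_n^2}{(3a_n+c_n)(a_n+3c_n)-b_n^2},$$ with initial values $a_0=a$, $b_0=b$, $c_0=c$. *)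

theory Defs
  imports "HOL-Analysis.Analysis"
begin

definition landen_denom :: "real \<Rightarrow> real \<Rightarrow> real \<Rightarrow> real" where
  "landen_denom a b c = (3 * a + c) * (a + 3 * c) - b\<^sup>2"

(* The denominator equals 3 (a + c)^2 + (4 a c - b^2), so it is positive whenever
   4 a c - b^2 > 0; the convention x / 0 = 0 then plays no role. *)
definition landen_step :: "real \<times> real \<times> real \<Rightarrow> real \<times> real \<times> real" where
  "landen_step = (\<lambda>(a, b, c).
     (a * (((a + 3 * c)\<^sup>2 - 3 * b\<^sup>2) / landen_denom a b c),
      b * ((3 * (a - c)\<^sup>2 - b\<^sup>2) / landen_denom a b c),
      c * (((3 * a + c)\<^sup>2 - 3 * b\<^sup>2) / landen_denom a b c)))"

end

theory Submission
  imports Defs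
begin

text \<open>
  The transformation becomes transparent in the coordinates $S = a + c$ and $w = (a - c) + i b$.
  Write $D = 4ac - b^2$, so that $S^2 = |w|^2 + D$; the denominator is $q = 4S^2 - |w|^2$,
  that is, $q = 3S^2 + D = 3|w|^2 + 4D$. One step is
    \[ S \mapsto S\,(S^2 + 3D)/q, \qquad w \mapsto w^3/q, \]
  Halley's iteration for $\sqrt D$ in $S$, and a cube in $w$. Three consequences give the limit.
  The step preserves $D$, because $S^2(S^2+3D)^2 - (S^2-D)^3 = D\,(3S^2+D)^2$. It preserves the
  sign of $S$. It divides the defect $|w|^2$ by at least 9, because $|w|^2 \mapsto |w|^6/q^2$
  and $3|w|^2 \le q$. So $w_n \to 0$, which
  says that $a_n - c_n$ and $b_n$ tend to 0, and then $S_n = \sqrt{|w_n|^2 + D} \to \sqrt D$.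
\<close>

lemma landen_denom_eq_defect:
  "landen_denom a b c = 3 * ((a - c)\<^sup>2 + b\<^sup>2) + 4 * (4 * a * c - b\<^sup>2)"
  by (simp add: landen_denom_def power2_eq_square algebra_simps)

text \<open>The coordinate form of a step, free of division; the second and third equations are the
  real and imaginary parts of $q w' = w^3$.\<close>

lemma landen_step_diagonalized:
  fixes a b c a' b' c' :: real
  assumes step: "(a', b', c') = landen_step (a, b, c)"
    and D: "4 * a * c - b\<^sup>2 > 0"
  shows "landen_denom a b c * (a' + c') = (a + c) * ((a + c)\<^sup>2 + 3 * (4 * a * c - b\<^sup>2))"
    and "landen_denom a b c * (a' - c') = (a - c) ^ 3 - 3 * (a - c) * b\<^sup>2"
    and "landen_denom a b c * b' = 3 * (a - c)\<^sup>2 * b - b ^ 3"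
proof -
  let ?q = "landen_denom a b c"
  have "?q > 0"
    unfolding landen_denom_eq_defect using D by (intro add_nonneg_pos) auto
  then have a': "?q * a' = a * ((a + 3 * c)\<^sup>2 - 3 * b\<^sup>2)"
    and b': "?q * b' = b * (3 * (a - c)\<^sup>2 - b\<^sup>2)"
    and c': "?q * c' = c * ((3 * a + c)\<^sup>2 - 3 * b\<^sup>2)"
    using step by (auto simp: landen_step_def)
  show "?q * (a' + c') = (a + c) * ((a + c)\<^sup>2 + 3 * (4 * a * c - b\<^sup>2))"
    unfolding distrib_left a' c' by (simp add: power2_eq_square algebra_simps)
  show "?q * (a' - c') = (a - c) ^ 3 - 3 * (a - c) * b\<^sup>2"
    unfolding right_diff_distrib a' c' by (simp add: power2_eq_square power3_eq_cube algebra_simps)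
  show "?q * b' = 3 * (a - c)\<^sup>2 * b - b ^ 3"
    unfolding b' by (simp add: power2_eq_square power3_eq_cube algebra_simps)
qed

text \<open>The two identities behind this are $|w'|^2 = |w|^6/q^2$ and, with $S^2 = |w|^2 + D$,
  $S'^2 - |w'|^2 = D$; the constant 9 is the square of the 3 in $q = 3|w|^2 + 4D \ge 3|w|^2$.\<close>

lemma landen_step_props:
  fixes a b c a' b' c' :: real
  assumes step: "(a', b', c') = landen_step (a, b, c)"
    and D: "4 * a * c - b\<^sup>2 > 0" and S: "a + c > 0"
  shows landen_step_discriminant: "4 * a' * c' - b'\<^sup>2 = 4 * a * c - b\<^sup>2"
    and landen_step_sum_pos: "a' + c' > 0"
    and landen_step_defect_le: "(a' - c')\<^sup>2 + b'\<^sup>2 \<le> ((a - c)\<^sup>2 + b\<^sup>2) / 9"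
proof -
  define q where "q = landen_denom a b c"
  define E where "E = (a - c)\<^sup>2 + b\<^sup>2"
  define D where "D = 4 * a * c - b\<^sup>2"
  define E' where "E' = (a' - c')\<^sup>2 + b'\<^sup>2"
  note coords = landen_step_diagonalized[OF step assms(2), folded q_def]
  have E: "E \<ge> 0" and q: "q = 3 * E + 4 * D" and D: "D > 0"
    using assms(2) by (auto simp: E_def q_def D_def landen_denom_eq_defect)
  have q0: "q > 0" using E q D by simp
  have SE: "(a + c)\<^sup>2 = E + D"
    by (simp add: E_def D_def power2_eq_square algebra_simps)

  have "q * (a' + c') > 0"
    unfolding coords(1) using S D[unfolded D_def]
    by (intro mult_pos_pos[OF S] add_nonneg_pos) (simp_all del: diff_gt_0_iff_gt)
  then show "a' + c' > 0" using q0 by (simp add: zero_less_mult_iff)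

  have "q\<^sup>2 * E' = (q * (a' - c'))\<^sup>2 + (q * b')\<^sup>2"
    by (simp add: E'_def power_mult_distrib distrib_left)
  also have "\<dots> = E ^ 3"
    unfolding coords E_def by (simp add: power2_eq_square power3_eq_cube algebra_simps)
  finally have E'q: "q\<^sup>2 * E' = E ^ 3" .

  have "q\<^sup>2 * (4 * a' * c' - b'\<^sup>2) = (q * (a' + c'))\<^sup>2 - q\<^sup>2 * E'"
    by (simp add: E'_def power2_eq_square algebra_simps)
  also have "\<dots> = (a + c)\<^sup>2 * ((a + c)\<^sup>2 + 3 * D)\<^sup>2 - E ^ 3"
    unfolding E'q coords(1) by (simp add: D_def power_mult_distrib)
  also have "\<dots> = q\<^sup>2 * D"
    unfolding SE q by (simp add: power2_eq_square power3_eq_cube algebra_simps)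
  finally show "4 * a' * c' - b'\<^sup>2 = 4 * a * c - b\<^sup>2"
    using q0 by (simp add: D_def)

  have "q\<^sup>2 * E' = E * E\<^sup>2"
    unfolding E'q by (simp add: power2_eq_square power3_eq_cube)
  also have "\<dots> \<le> E * (q / 3)\<^sup>2"
    using E q D by (intro mult_left_mono power_mono) auto
  also have "\<dots> = q\<^sup>2 * (E / 9)" by (simp add: power2_eq_square)
  finally show "E' \<le> E / 9" using q0 by simp
qed

theorem mainTheorem2:
  fixes a b c :: real and A B C :: "nat \<Rightarrow> real"
  assumes "4 * a * c - b\<^sup>2 > 0" and "a + c > 0"
    and "A 0 = a" and "B 0 = b" and "C 0 = c"
    and "\<And>n. (A (Suc n), B (Suc n), C (Suc n)) = landen_step (A n, B n, C n)"
  shows "A \<longlonglongrightarrow> sqrt (4 * a * c - b\<^sup>2) / 2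
       \<and> C \<longlonglongrightarrow> sqrt (4 * a * c - b\<^sup>2) / 2
       \<and> B \<longlonglongrightarrow> 0"
proof -
  define D where "D = 4 * a * c - b\<^sup>2"
  define E where "E n = (A n - C n)\<^sup>2 + (B n)\<^sup>2" for n
  have inv: "4 * A n * C n - (B n)\<^sup>2 = D \<and> A n + C n > 0" for n
  proof (induction n)
    case 0
    then show ?case using assms(2-5) by (simp add: D_def)
  next
    case (Suc n)
    then show ?case
      using landen_step_discriminant[OF assms(6)[of n]] landen_step_sum_pos[OF assms(6)[of n]]
        assms(1) by (simp add: D_def)
  qed
  have E_step: "E (Suc n) \<le> E n / 9" for n
    using landen_step_defect_le[OF assms(6)[of n]] inv[of n] assms(1)
    by (simp add: E_def D_def)
  have E_le: "E n \<le> E 0 * (1 / 9) ^ n" for n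
  proof (induction n)
    case (Suc n)
    then show ?case using E_step[of n] by simp
  qed simp
  have bound_lim: "(\<lambda>n. E 0 * (1 / 9) ^ n) \<longlonglongrightarrow> 0"
    by (intro tendsto_mult_right_zero LIMSEQ_realpow_zero) auto
  have "E n \<ge> 0" for n by (simp add: E_def)
  with E_le have E_lim: "E \<longlonglongrightarrow> 0"
    by (intro tendsto_sandwich[OF _ _ tendsto_const bound_lim]) (auto intro!: always_eventually)

  have null: "f \<longlonglongrightarrow> 0" if "\<And>n. (f n)\<^sup>2 \<le> E n" for f :: "nat \<Rightarrow> real"
  proof -
    have "(\<lambda>n. (f n)\<^sup>2) \<longlonglongrightarrow> 0"
      by (rule tendsto_sandwich[OF _ _ tendsto_const E_lim]) (auto simp: that)
    then show ?thesis by simp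
  qed
  have B: "B \<longlonglongrightarrow> 0" and diff: "(\<lambda>n. A n - C n) \<longlonglongrightarrow> 0"
    by (auto intro!: null simp: E_def)

  have "A n + C n = sqrt (E n + D)" for n
  proof (rule real_sqrt_unique[symmetric])
    show "(A n + C n)\<^sup>2 = E n + D"
      unfolding conjunct1[OF inv[of n], symmetric]
      by (simp add: E_def power2_eq_square algebra_simps)
  qed (use inv[of n] in simp)
  moreover have "(\<lambda>n. sqrt (E n + D)) \<longlonglongrightarrow> sqrt (0 + D)"
    by (intro tendsto_intros E_lim)
  ultimately have sum: "(\<lambda>n. A n + C n) \<longlonglongrightarrow> sqrt D" by simp

  have "(\<lambda>n. ((A n + C n) + (A n - C n)) / 2) \<longlonglongrightarrow> (sqrt D + 0) / 2"
    by (intro tendsto_intros sum diff) auto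
  moreover have "(\<lambda>n. ((A n + C n) - (A n - C n)) / 2) \<longlonglongrightarrow> (sqrt D - 0) / 2"
    by (intro tendsto_intros sum diff) auto
  ultimately show ?thesis using B by (simp add: D_def)
qed

end
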